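(* Fix a deterministic valuation sequence $V_1,\ldots,V_T$ and a time $t\in\{1,\ldots,T\}$, and consider a run of Algorithm VT. Let $i^*_t$ be the (deterministic) inventory unit assigned to customer $t$, and let $\mathtt{sold}[i^*_t]$ denote its value at the start of iteration $t$ (so that $\Pr[\mathtt{sold}[i^*_t]=\mathtt{true}\mid I_{t-1}=k']$ is the probability that Algorithm VT$'$ rejects customer $t$ when it has $k'$ units remaining). Suppose $\Pr[\mathtt{sold}[i^*_t]=\mathtt{true}]\in(0,1)$. Then for any $k_1<k_2$ with $\Pr[I_{t-1}=k_1]>0$ and $\Pr[I_{t-1}=k_2]>0$, $\Pr[\mathtt{sold}[i^*_t]=\mathtt{true}\mid I_{t-1}=k_1]>\Pr[\mathtt{sold}[i^*_t]=\mathtt{true}\mid I_{t-1}=k_2]$.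
   Context: Setting (single-item dynamic pricing, deterministic valuations). Fix $m\ge1$, prices $0<r^{(1)}<\cdots<r^{(m)}$, $r^{(0)}=0$, $r^{(m+1)}=\infty$, inventory $k\ge1$. Customers $t=1,\ldots,T$ have valuations $V_t\in\{r^{(0)},\ldots,r^{(m)}\}$; $X_t=\mathbb{1}(V_t\ge P_t)$ where $P_t$ is the offered price; $I_t=k-\sum_{t'\le t}X_{t'}$ is the remaining inventory at the end of time $t$. Let $q^{(j)}=1-r^{(j-1)}/r^{(j)}$. Algorithm VT: initialize $\mathtt{level}[i]=0$, $\mathtt{sold}[i]=\mathtt{false}$ for $i=1,\ldots,k$. For each customer $t$: let $i^*_t$ minimize $\mathtt{level}[i]$ (fixed deterministic tie-breaking), and $\ell_t$ satisfy $\mathtt{level}[i^*_t]=r^{(\ell_t)}$. If $\mathtt{sold}[i^*_t]=\mathtt{false}$, choose price $r^{(j)}$, $j\in\{\ell_t+1,\ldots,m\}$, w.p. $q^{(j)}/\sum_{j'=\ell_t+1}^mq^{(j')}$; else price $\infty$. Then observe $V_t,X_t$, set $\mathtt{level}[i^*_t]=\max\{\mathtt{level}[i^*_t],V_t\}$, and if $X_t=1$ set $\mathtt{sold}[i^*_t]=\mathtt{true}$. Algorithm VT$'$: at time $t$ with remaining inventory $k'$, it rejects (offers $\infty$) with probability $\Pr[\mathtt{sold}[i^*_t]=\mathtt{true}\mid I_{t-1}=k']$ computed in a run of Algorithm VT, and otherwise offers a price from the distribution Algorithm VT uses when $\mathtt{sold}[i^*_t]=\mathtt{false}$. *)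

theory Defs
  imports "HOL-Probability.Probability"
begin

text \<open>
  Prices are \<open>r 1 < \<dots> < r m\<close> with \<open>r 0 = 0\<close>; the rejection price \<open>r (m + 1) = \<infinity>\<close> is the
  \<open>ereal\<close> value \<open>\<infinity>\<close>. Inventory units are \<open>1, \<dots>, k\<close>, customers are \<open>1, 2, \<dots>\<close>.
\<close>

definition q :: "(nat \<Rightarrow> real) \<Rightarrow> nat \<Rightarrow> real" where
  "q r j = 1 - r (j - 1) / r j"

text \<open>
  Only meaningful for \<open>l < m\<close>. A unit of level \<open>r m\<close> is sold almost surely, so the unspecified
  value at \<open>l = m\<close> does not affect the law of the run.
\<close>

definition price_index :: "(nat \<Rightarrow> real) \<Rightarrow> nat \<Rightarrow> nat \<Rightarrow> nat pmf" where
  "price_index r m l =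
     embed_pmf (\<lambda>j. if j \<in> {l+1..m} then q r j / (\<Sum>j'=l+1..m. q r j') else 0)"

lemma pmf_price_index:
  assumes "r 0 = 0" "strict_mono_on {0..m} r" "l < m"
  shows "pmf (price_index r m l) j =
           (if j \<in> {l+1..m} then q r j / (\<Sum>j'=l+1..m. q r j') else 0)"
proof -
  have q: "q r j > 0" if "j \<in> {l+1..m}" for j
  proof -
    have "r (j - 1) < r j" "r 0 < r j"
      using that strict_mono_onD[OF assms(2), of "j - 1" j] strict_mono_onD[OF assms(2), of 0 j]
      by (auto simp: le_diff_conv)
    then show ?thesis using assms(1) by (simp add: q_def)
  qed
  then have S: "(\<Sum>j'=l+1..m. q r j') > 0"
    using assms(3) by (intro sum_pos) auto
  define f where "f j = (if j \<in> {l+1..m} then q r j / (\<Sum>j'=l+1..m. q r j') else 0)" for j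
  have nonneg: "f j \<ge> 0" for j
    using q[of j] S by (auto simp: f_def intro!: divide_nonneg_pos less_imp_le)
  have "(\<integral>\<^sup>+ j. ennreal (f j) \<partial>count_space UNIV) = (\<Sum>j=l+1..m. ennreal (f j))"
    by (intro nn_integral_count_space') (auto simp: f_def)
  also have "\<dots> = ennreal (\<Sum>j=l+1..m. f j)"
    using nonneg by (intro sum_ennreal) auto
  also have "(\<Sum>j=l+1..m. f j) = (\<Sum>j=l+1..m. q r j / (\<Sum>j'=l+1..m. q r j'))"
    by (intro sum.cong) (auto simp: f_def)
  also have "\<dots> = 1"
    using S by (simp flip: sum_divide_distrib)
  finally have "pmf (embed_pmf f) j = f j"
    using nonneg by (intro pmf_embed_pmf) auto
  then show ?thesis by (simp add: price_index_def f_def[abs_def])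
qed

record vt_state =
  level :: "nat \<Rightarrow> real"
  sold :: "nat \<Rightarrow> bool"
  bought :: "nat \<Rightarrow> bool"  \<comment> \<open>\<open>bought s t\<close> holds iff \<open>X\<^sub>t = 1\<close>; false for customers still to come\<close>

definition vt_init :: vt_state where
  "vt_init = \<lparr>level = (\<lambda>_. 0), sold = (\<lambda>_. False), bought = (\<lambda>_. False)\<rparr>"

text \<open>
  The tie-breaking rule \<open>tie t\<close> selects, for customer \<open>t\<close>, a minimizer of the given level vector.
  It does not see the outcomes of the random prices.
\<close>

definition tie_breaking :: "nat \<Rightarrow> (nat \<Rightarrow> (nat \<Rightarrow> real) \<Rightarrow> nat) \<Rightarrow> bool" where
  "tie_breaking k tie \<longleftrightarrow> (\<forall>t lev. is_arg_min lev (\<lambda>i. i \<in> {1..k}) (tie t lev))"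

definition assigned_unit :: "(nat \<Rightarrow> (nat \<Rightarrow> real) \<Rightarrow> nat) \<Rightarrow> nat \<Rightarrow> vt_state \<Rightarrow> nat" where
  "assigned_unit tie t s = tie t (level s)"

definition level_index :: "(nat \<Rightarrow> real) \<Rightarrow> nat \<Rightarrow> real \<Rightarrow> nat" where
  "level_index r m x = (THE l. l \<le> m \<and> r l = x)"

definition vt_price :: "(nat \<Rightarrow> real) \<Rightarrow> nat \<Rightarrow> nat \<Rightarrow> vt_state \<Rightarrow> ereal pmf" where
  "vt_price r m i s =
     (if sold s i then return_pmf \<infinity>
      else map_pmf (\<lambda>j. ereal (r j)) (price_index r m (level_index r m (level s i))))"

definition vt_update :: "nat \<Rightarrow> nat \<Rightarrow> real \<Rightarrow> ereal \<Rightarrow> vt_state \<Rightarrow> vt_state" where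
  "vt_update t i v p s =
     (let x = (ereal v \<ge> p) in
      \<lparr>level = (level s)(i := max (level s i) v),
       sold = (sold s)(i := sold s i \<or> x),
       bought = (bought s)(t := x)\<rparr>)"

definition vt_step ::
  "(nat \<Rightarrow> real) \<Rightarrow> nat \<Rightarrow> (nat \<Rightarrow> (nat \<Rightarrow> real) \<Rightarrow> nat) \<Rightarrow> (nat \<Rightarrow> real) \<Rightarrow> nat \<Rightarrow> vt_state \<Rightarrow> vt_state pmf"
where
  "vt_step r m tie V t s =
     (let i = assigned_unit tie t s
      in map_pmf (\<lambda>p. vt_update t i (V t) p s) (vt_price r m i s))"

text \<open>Law of the state at the end of time \<open>n\<close>, i.e.\ at the start of iteration \<open>n + 1\<close>.\<close>

primrec vt_run ::
  "(nat \<Rightarrow> real) \<Rightarrow> nat \<Rightarrow> (nat \<Rightarrow> (nat \<Rightarrow> real) \<Rightarrow> nat) \<Rightarrow> (nat \<Rightarrow> real) \<Rightarrow> nat \<Rightarrow> vt_state pmf"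
where
  "vt_run r m tie V 0 = return_pmf vt_init"
| "vt_run r m tie V (Suc n) = bind_pmf (vt_run r m tie V n) (vt_step r m tie V (Suc n))"

definition inventory :: "nat \<Rightarrow> nat \<Rightarrow> vt_state \<Rightarrow> int" where
  "inventory k t s = int k - (\<Sum>t'=1..t. of_bool (bought s t'))"

end

theory Submission imports Defs begin

text \<open>
  Levels evolve deterministically, so the flags \<open>sold i\<close> stay independent throughout the run. If
  \<open>a\<close> is the mass function of the number of sold units other than the assigned one, and \<open>p\<close> is the
  probability that the assigned unit is sold, then with \<open>n = k - k'\<close> the conditional probability is
  \<open>p * a (n - 1) / (p * a (n - 1) + (1 - p) * a n)\<close>. It is strictly increasing in \<open>n\<close> because a
  sum of independent Bernoulli variables has a strictly log-concave mass function.
\<close>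

section \<open>Strict log-concavity and Bernoulli convolution\<close>

text \<open>The inequality ranges over pairs \<open>n \<le> m\<close> rather than only
  \<open>n = m\<close>: this form survives convolution without any division. Indexing by
  \<open>int\<close> gives \<open>a (n - 1)\<close> a meaning at the lower end of the
  support.\<close>

definition strictly_log_concave_on :: "int \<Rightarrow> int \<Rightarrow> (int \<Rightarrow> real) \<Rightarrow> bool" where
  "strictly_log_concave_on lo hi a \<longleftrightarrow>
     lo \<le> hi \<and> (\<forall>n. a n \<ge> 0) \<and> (\<forall>n. a n > 0 \<longleftrightarrow> lo \<le> n \<and> n \<le> hi) \<and>
     (\<forall>n m. lo \<le> n \<longrightarrow> n \<le> m \<longrightarrow> m \<le> hi \<longrightarrow> a (n - 1) * a (m + 1) < a n * a m)"

lemma strictly_log_concave_onD: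
  assumes "strictly_log_concave_on lo hi a"
  shows "lo \<le> hi" "a n \<ge> 0" "a n > 0 \<longleftrightarrow> lo \<le> n \<and> n \<le> hi"
    and "lo \<le> n \<Longrightarrow> n \<le> m \<Longrightarrow> m \<le> hi \<Longrightarrow> a (n - 1) * a (m + 1) < a n * a m"
  using assms unfolding strictly_log_concave_on_def by blast+

lemma strictly_log_concave_on_eq_0:
  assumes "strictly_log_concave_on lo hi a" "n < lo \<or> hi < n"
  shows "a n = 0"
  using strictly_log_concave_onD(2,3)[OF assms(1), of n] assms(2) by force

text \<open>Once \<open>n\<close> or \<open>m\<close> leaves the support interval, a factor on the
  left vanishes, so the weak inequality needs no range condition.\<close>

lemma strictly_log_concave_on_le:
  assumes "strictly_log_concave_on lo hi a" "n \<le> m"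
  shows "a (n - 1) * a (m + 1) \<le> a n * a m"
proof (cases "lo \<le> n \<and> m \<le> hi")
  case True
  then show ?thesis
    using strictly_log_concave_onD(4)[OF assms(1), of n m] assms(2) by simp
next
  case False
  then have "a (n - 1) = 0 \<or> a (m + 1) = 0"
    using strictly_log_concave_on_eq_0[OF assms(1)] by force
  then show ?thesis
    using strictly_log_concave_onD(2)[OF assms(1)] by auto
qed

text \<open>Adding an independent Bernoulli variable turns the mass function \<open>a\<close> into
  this mixture. For \<open>p = 0\<close> nothing changes, for \<open>p = 1\<close> the support
  shifts by one, and otherwise it grows by one at the upper end.\<close>

lemma strictly_log_concave_on_bernoulli:
  assumes a: "strictly_log_concave_on lo hi a" and p: "0 \<le> p" "p \<le> 1"
  shows "\<exists>lo' hi'. strictly_log_concave_on lo' hi' (\<lambda>n. p * a (n - 1) + (1 - p) * a n)"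
proof -
  note D = strictly_log_concave_onD[OF a]
  note Z = strictly_log_concave_on_eq_0[OF a]
  consider "p = 0" | "p = 1" | "0 < p" "p < 1"
    using p by linarith
  then show ?thesis
  proof cases
    case 1
    then show ?thesis using a by auto
  next
    case 2
    have "strictly_log_concave_on (lo + 1) (hi + 1) (\<lambda>n. a (n - 1))"
      unfolding strictly_log_concave_on_def
      using D(1-3) D(4)[of "_ - 1" "_ - 1"] by (auto simp: algebra_simps)
    then show ?thesis using 2 by auto
  next
    case 3
    let ?c = "\<lambda>n. p * a (n - 1) + (1 - p) * a n"
    have nonneg: "?c n \<ge> 0" for n
      using 3 D(2) by simp
    have pos: "?c n > 0 \<longleftrightarrow> lo \<le> n \<and> n \<le> hi + 1" for n
    proof (cases "lo \<le> n \<and> n \<le> hi + 1")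
      case True
      then have "a (n - 1) > 0 \<or> a n > 0"
        using D(1) D(3)[of n] D(3)[of "n - 1"] by linarith
      then have "?c n > 0"
        using 3 D(2)[of n] D(2)[of "n - 1"]
        by (auto intro: add_pos_nonneg add_nonneg_pos)
      then show ?thesis using True by simp
    next
      case False
      then have "a n = 0" "a (n - 1) = 0"
        using Z by auto
      then show ?thesis using False by simp
    qed
    have conc: "?c (n - 1) * ?c (m + 1) < ?c n * ?c m" if nm: "lo \<le> n" "n \<le> m" "m \<le> hi + 1" for n m
    proof -
      \<comment> \<open>Coefficients of \<open>p * p\<close>, \<open>(1 - p) * (1 - p)\<close> and
        \<open>p * (1 - p)\<close> in \<open>?c n * ?c m - ?c (n - 1) * ?c (m + 1)\<close>; the
        mixed terms \<open>a (n - 1) * a m\<close> cancel.\<close>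
      define A where "A = a (n - 1) * a (m - 1) - a (n - 2) * a m"
      define B where "B = a n * a m - a (n - 1) * a (m + 1)"
      define C where "C = a n * a (m - 1) - a (n - 2) * a (m + 1)"
      have A: "A \<ge> 0"
        using strictly_log_concave_on_le[OF a, of "n - 1" "m - 1"] nm by (simp add: A_def)
      have B: "B \<ge> 0"
        using strictly_log_concave_on_le[OF a, of n m] nm by (simp add: B_def)
      \<comment> \<open>\<open>C\<close> spans a gap of two steps, bridged through
        \<open>a (n - 1) * a m\<close>. For \<open>n = m\<close> the second bridge is an
        equality.\<close>
      have outer: "a (n - 2) * a (m + 1) \<le> a (n - 1) * a m"
        using strictly_log_concave_on_le[OF a, of "n - 1" m] nm by simp
      have inner: "a (n - 1) * a m \<le> a n * a (m - 1)"
        using strictly_log_concave_on_le[OF a, of n "m - 1"] nm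
        by (cases "n = m") (auto simp: mult.commute)
      have C: "C \<ge> 0"
        using outer inner by (simp add: C_def)
      \<comment> \<open>Strictness comes from \<open>B\<close> inside the old support. At the new
        endpoint \<open>m = hi + 1\<close> it comes from \<open>C\<close>, or from \<open>A\<close>
        when also \<open>n = hi + 1\<close>.\<close>
      have strict: "A > 0 \<or> B > 0 \<or> C > 0"
      proof -
        consider "m \<le> hi" | "m = hi + 1" "n \<le> hi" | "m = hi + 1" "n = hi + 1"
          using nm by linarith
        then show ?thesis
        proof cases
          case 1
          then show ?thesis using D(4)[of n m] nm by (simp add: B_def)
        next
          case 2
          then have "a (m + 1) = 0" "a n * a (m - 1) > 0"
            using Z[of "m + 1"] D(3)[of n] D(3)[of "m - 1"] nm by auto
          then show ?thesis by (simp add: C_def)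
        next
          case 3
          then have "a m = 0" "a (n - 1) * a (m - 1) > 0"
            using Z[of m] D(1) D(3)[of hi] by auto
          then show ?thesis by (simp add: A_def)
        qed
      qed
      have "?c n * ?c m - ?c (n - 1) * ?c (m + 1) = p * p * A + (1 - p) * (1 - p) * B + p * (1 - p) * C"
        by (simp add: A_def B_def C_def algebra_simps)
      moreover have "p * p * A \<ge> 0" "(1 - p) * (1 - p) * B \<ge> 0" "p * (1 - p) * C \<ge> 0"
        using A B C 3 by simp_all
      moreover have "p * p * A > 0 \<or> (1 - p) * (1 - p) * B > 0 \<or> p * (1 - p) * C > 0"
        using strict 3 by (auto simp: zero_less_mult_iff)
      ultimately show ?thesis by linarith
    qed
    have "strictly_log_concave_on lo (hi + 1) ?c"
      unfolding strictly_log_concave_on_def using D(1) nonneg pos conc by auto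
    then show ?thesis by blast
  qed
qed

text \<open>Cross-multiplied monotonicity of \<open>a (n - 1) / a n\<close>, which stays meaningful
  when a denominator is zero. The positivity hypotheses force \<open>lo \<le> n\<close> and
  \<open>m - 1 \<le> hi\<close>, so strict concavity applies at \<open>n\<close> and
  \<open>m - 1\<close>.\<close>

lemma strictly_log_concave_on_pair_less:
  assumes a: "strictly_log_concave_on lo hi a" and less: "n < m"
    and "a (n - 1) > 0 \<or> a n > 0" "a (m - 1) > 0 \<or> a m > 0"
  shows "a (n - 1) * a m < a n * a (m - 1)"
proof -
  have "lo \<le> n" "m - 1 \<le> hi"
    using assms(3,4) strictly_log_concave_onD(3)[OF a] by force+
  then show ?thesis
    using strictly_log_concave_onD(4)[OF a, of n "m - 1"] less by simp
qed

section \<open>Sums of independent Boolean variables\<close>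

abbreviation bool_sum_pmf :: "'a set \<Rightarrow> ('a \<Rightarrow> bool pmf) \<Rightarrow> int pmf" where
  "bool_sum_pmf A D \<equiv> map_pmf (\<lambda>f. \<Sum>i\<in>A. of_bool (f i)) (Pi_pmf A False D)"

lemma prob_pair_bool_pmf:
  fixes P :: "bool pmf"
  shows "measure_pmf.prob (pair_pmf P Q) {x. R x} =
    pmf P True * measure_pmf.prob Q {y. R (True, y)} +
    (1 - pmf P True) * measure_pmf.prob Q {y. R (False, y)}"
proof -
  have "measure_pmf.prob (pair_pmf P Q) {x. R x} = pmf (map_pmf R (pair_pmf P Q)) True"
    by (simp add: pmf_map vimage_def)
  also have "map_pmf R (pair_pmf P Q) = bind_pmf P (\<lambda>b. map_pmf (\<lambda>y. R (b, y)) Q)"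
    by (simp add: pair_pmf_def map_pmf_def bind_assoc_pmf bind_return_pmf)
  also have "pmf \<dots> True = measure_pmf.expectation P (\<lambda>b. measure_pmf.prob Q {y. R (b, y)})"
    by (simp add: pmf_bind pmf_map vimage_def)
  also have "\<dots> = (\<Sum>b\<in>UNIV. measure_pmf.prob Q {y. R (b, y)} * pmf P b)"
    by (intro integral_measure_pmf_real) auto
  finally show ?thesis
    by (simp add: UNIV_bool pmf_False_conv_True algebra_simps)
qed

text \<open>Coordinate \<open>i\<close> is kept next to the total because conditioning needs their
  joint law; projecting to the total gives the convolution step for induction.\<close>

lemma Pi_pmf_insert_count:
  assumes "finite A" "i \<notin> A"
  shows "map_pmf (\<lambda>f. (f i, \<Sum>j\<in>insert i A. of_bool (f j) :: int)) (Pi_pmf (insert i A) False D) =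
    map_pmf (\<lambda>(b, s). (b, of_bool b + s)) (pair_pmf (D i) (bool_sum_pmf A D))"
proof -
  have "(\<Sum>j\<in>A. of_bool ((f(i := b)) j)) = (\<Sum>j\<in>A. of_bool (f j) :: int)" for f b
    using assms(2) by (intro sum.cong) auto
  moreover have "pair_pmf (D i) (bool_sum_pmf A D) =
      map_pmf (\<lambda>(b, f). (b, \<Sum>j\<in>A. of_bool (f j))) (pair_pmf (D i) (Pi_pmf A False D))"
    by (simp add: pair_map_pmf2 apsnd_def map_prod_def case_prod_beta del: sum_of_bool_eq)
  ultimately show ?thesis
    using assms
    by (simp add: Pi_pmf_insert pmf.map_comp o_def case_prod_beta del: sum_of_bool_eq)
qed

lemma strictly_log_concave_on_bool_sum:
  assumes "finite A"
  shows "\<exists>lo hi. strictly_log_concave_on lo hi (pmf (bool_sum_pmf A D))"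
  using assms
proof (induction A)
  case empty
  have "strictly_log_concave_on 0 0 (pmf (return_pmf (0 :: int)))"
    by (auto simp: strictly_log_concave_on_def indicator_def split: if_splits)
  then show ?case by (auto simp del: pmf_return)
next
  case (insert i A)
  let ?W = "bool_sum_pmf A D"
  have "bool_sum_pmf (insert i A) D =
      map_pmf snd (map_pmf (\<lambda>f. (f i, \<Sum>j\<in>insert i A. of_bool (f j) :: int)) (Pi_pmf (insert i A) False D))"
    by (simp add: pmf.map_comp o_def)
  also have "\<dots> = map_pmf (\<lambda>(b, s). of_bool b + s) (pair_pmf (D i) ?W)"
    by (simp add: Pi_pmf_insert_count[OF insert.hyps] pmf.map_comp o_def case_prod_unfold
        del: sum_of_bool_eq)
  finally have "pmf (bool_sum_pmf (insert i A) D) n =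
      measure_pmf.prob (pair_pmf (D i) ?W) {x. (case x of (b, s) \<Rightarrow> of_bool b + s) = n}" for n
    by (simp add: pmf_map vimage_def)
  moreover have "{y :: int. 1 + y = n} = {n - 1}" for n
    by auto
  ultimately have "pmf (bool_sum_pmf (insert i A) D) =
      (\<lambda>n. pmf (D i) True * pmf ?W (n - 1) + (1 - pmf (D i) True) * pmf ?W n)"
    by (intro ext) (simp add: prob_pair_bool_pmf pmf.rep_eq)
  moreover obtain lo hi where "strictly_log_concave_on lo hi (pmf ?W)"
    using insert.IH by blast
  ultimately show ?case
    using strictly_log_concave_on_bernoulli[OF _ pmf_nonneg pmf_le_1] by simp
qed

text \<open>The kernel reads and rewrites coordinate \<open>i\<close> alone, so it commutes with
  sampling the other coordinates and changes just one factor of the product.\<close>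

lemma Pi_pmf_bind_update:
  assumes "finite A" "i \<in> A"
  shows "bind_pmf (Pi_pmf A d D) (\<lambda>f. map_pmf (\<lambda>b. f(i := b)) (K (f i))) =
    Pi_pmf A d (D(i := bind_pmf (D i) K))"
proof -
  define B where "B = A - {i}"
  have A: "A = insert i B" "finite B" "i \<notin> B"
    using assms by (auto simp: B_def)
  have "Pi_pmf B d (D(i := bind_pmf (D i) K)) = Pi_pmf B d D"
    using A by (intro Pi_pmf_cong) auto
  then show ?thesis
    unfolding A(1) using A(2,3)
    by (simp add: Pi_pmf_insert pair_pmf_def map_pmf_def bind_assoc_pmf bind_return_pmf)
      (subst bind_commute_pmf, rule refl)
qed

section \<open>Independence of the sold flags in a run\<close>

text \<open>The level update uses the valuation and never the random price, and tie-breaking sees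
  only levels. Hence the assigned unit is deterministic too.\<close>

lemma vt_run_level_deterministic:
  "\<exists>L. \<forall>s\<in>set_pmf (vt_run r m tie V n). level s = L"
proof (induction n)
  case 0
  then show ?case by simp
next
  case (Suc n)
  then obtain L where L: "\<And>s. s \<in> set_pmf (vt_run r m tie V n) \<Longrightarrow> level s = L"
    by blast
  let ?i = "tie (Suc n) L"
  have "\<forall>s\<in>set_pmf (vt_run r m tie V (Suc n)). level s = L(?i := max (L ?i) (V (Suc n)))"
    using L by (auto simp: vt_step_def vt_update_def assigned_unit_def Let_def)
  then show ?case by blast
qed

lemma tie_breaking_range: "tie_breaking k tie \<Longrightarrow> tie t lev \<in> {1..k}"
  by (simp add: tie_breaking_def is_arg_min_def)

text \<open>Each purchase flips exactly one flag from unsold to sold, which lets the inventory be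
  read off the flags.\<close>

lemma sum_bought_eq_sum_sold:
  assumes "tie_breaking k tie" "s \<in> set_pmf (vt_run r m tie V n)"
  shows "(\<Sum>t'=1..n. of_bool (bought s t') :: int) = (\<Sum>i\<in>{1..k}. of_bool (sold s i))"
  using assms(2)
proof (induction n arbitrary: s)
  case 0
  then show ?case by (simp add: vt_init_def)
next
  case (Suc n)
  then obtain s' p where s': "s' \<in> set_pmf (vt_run r m tie V n)"
    and p: "p \<in> set_pmf (vt_price r m (assigned_unit tie (Suc n) s') s')"
    and s: "s = vt_update (Suc n) (assigned_unit tie (Suc n) s') (V (Suc n)) p s'"
    by (auto simp: vt_step_def Let_def)
  define i where "i = assigned_unit tie (Suc n) s'"
  define x where "x = (ereal (V (Suc n)) \<ge> p)"
  have i: "i \<in> {1..k}"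
    using tie_breaking_range[OF assms(1)] by (simp add: i_def assigned_unit_def)
  \<comment> \<open>A sold unit is priced at \<open>\<infinity>\<close>, which exceeds every real
    valuation.\<close>
  have x: "\<not> x" if "sold s' i"
    using p that by (simp add: i_def x_def vt_price_def)
  have bought: "bought s = (bought s')(Suc n := x)" and sold: "sold s = (sold s')(i := sold s' i \<or> x)"
    by (simp_all add: s vt_update_def Let_def i_def x_def)
  have "(\<Sum>t'=1..Suc n. of_bool (bought s t') :: int) = (\<Sum>t'=1..n. of_bool (bought s' t')) + of_bool x"
    by (simp add: bought)
  also have "\<dots> = (\<Sum>j\<in>{1..k}. of_bool (sold s' j)) + of_bool x"
    using Suc.IH[OF s'] by simp
  also have "\<dots> = (\<Sum>j\<in>{1..k}. of_bool (sold s j))"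
  proof -
    have "(\<Sum>j\<in>{1..k} - {i}. of_bool (sold s j)) = (\<Sum>j\<in>{1..k} - {i}. of_bool (sold s' j) :: int)"
      by (intro sum.cong) (auto simp: sold)
    then show ?thesis
      using i x
      unfolding sum.remove[OF finite_atLeastAtMost i] by (cases x) (auto simp: sold)
  qed
  finally show ?case .
qed

text \<open>With deterministic levels, each step acts on one fixed coordinate through a kernel
  depending only on that flag, so the product form persists.\<close>

lemma sold_independent:
  assumes "tie_breaking k tie"
  shows "\<exists>D. map_pmf sold (vt_run r m tie V n) = Pi_pmf {1..k} False D"
proof (induction n)
  case 0
  have "Pi_pmf {1..k} False (\<lambda>_. return_pmf False) = return_pmf (\<lambda>_. False)"
    by (simp add: Pi_pmf_return_pmf)
  then show ?case by (auto simp: vt_init_def intro!: exI[of _ "\<lambda>_. return_pmf False"])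
next
  case (Suc n)
  let ?M = "vt_run r m tie V n"
  obtain D where D: "map_pmf sold ?M = Pi_pmf {1..k} False D"
    using Suc by blast
  obtain L where L: "\<And>s. s \<in> set_pmf ?M \<Longrightarrow> level s = L"
    using vt_run_level_deterministic by blast
  define i where "i = tie (Suc n) L"
  \<comment> \<open>A sold flag stays sold; an unsold one becomes sold with the chance that a price
    drawn at the fixed level \<open>L i\<close> is at most the valuation.\<close>
  define K where "K b = (if b then return_pmf True else
    map_pmf (\<lambda>j. ereal (V (Suc n)) \<ge> ereal (r j)) (price_index r m (level_index r m (L i))))" for b
  have "map_pmf sold (vt_step r m tie V (Suc n) s) = map_pmf (\<lambda>b. (sold s)(i := b)) (K (sold s i))"
    if "s \<in> set_pmf ?M" for s
    using L[OF that]
    by (simp add: vt_step_def assigned_unit_def vt_price_def vt_update_def Let_def K_def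
        pmf.map_comp o_def i_def)
  then have "map_pmf sold (vt_run r m tie V (Suc n)) =
      bind_pmf ?M (\<lambda>s. map_pmf (\<lambda>b. (sold s)(i := b)) (K (sold s i)))"
    by (simp add: map_bind_pmf cong: bind_pmf_cong)
  also have "\<dots> = bind_pmf (map_pmf sold ?M) (\<lambda>f. map_pmf (\<lambda>b. f(i := b)) (K (f i)))"
    by (simp add: bind_map_pmf)
  also have "\<dots> = Pi_pmf {1..k} False (D(i := bind_pmf (D i) K))"
    using tie_breaking_range[OF assms] by (simp add: D i_def Pi_pmf_bind_update)
  finally show ?case by blast
qed

section \<open>Comparison of the conditional probabilities\<close>

theorem theorem3:
  fixes r V :: "nat \<Rightarrow> real" and m k T t :: nat
    and tie :: "nat \<Rightarrow> (nat \<Rightarrow> real) \<Rightarrow> nat"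
    and k1 k2 :: int
  assumes "m \<ge> 1" and "k \<ge> 1"
    and "r 0 = 0" and "strict_mono_on {0..m} r"
    and "\<forall>t'\<in>{1..T}. V t' \<in> r ` {0..m}"
    and "tie_breaking k tie"
    and "t \<in> {1..T}"
    and "\<P>(s in vt_run r m tie V (t - 1). sold s (assigned_unit tie t s)) \<in> {0<..<1}"
    and "k1 < k2"
    and "\<P>(s in vt_run r m tie V (t - 1). inventory k (t - 1) s = k1) > 0"
    and "\<P>(s in vt_run r m tie V (t - 1). inventory k (t - 1) s = k2) > 0"
  shows "\<P>(s in vt_run r m tie V (t - 1). sold s (assigned_unit tie t s) \<bar> inventory k (t - 1) s = k1)
       > \<P>(s in vt_run r m tie V (t - 1). sold s (assigned_unit tie t s) \<bar> inventory k (t - 1) s = k2)"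
proof -
  let ?M = "vt_run r m tie V (t - 1)"
  let ?S = "\<lambda>s. sold s (assigned_unit tie t s)"
  obtain L where L: "\<And>s. s \<in> set_pmf ?M \<Longrightarrow> level s = L"
    using vt_run_level_deterministic by blast
  obtain D where D: "map_pmf sold ?M = Pi_pmf {1..k} False D"
    using sold_independent[OF \<open>tie_breaking k tie\<close>] by blast
  define i where "i = tie t L"
  define A where "A = {1..k} - {i}"
  have A: "{1..k} = insert i A" "finite A" "i \<notin> A"
    using tie_breaking_range[OF \<open>tie_breaking k tie\<close>, of t L] by (auto simp: i_def A_def)
  define p where "p = pmf (D i) True"
  define W where "W = bool_sum_pmf A D"
  define a where "a = pmf W"
  have "map_pmf (\<lambda>s. (?S s, int k - inventory k (t - 1) s)) ?M =
      map_pmf (\<lambda>f. (f i, \<Sum>j\<in>{1..k}. of_bool (f j))) (map_pmf sold ?M)"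
    unfolding pmf.map_comp o_def
    using L sum_bought_eq_sum_sold[OF \<open>tie_breaking k tie\<close>]
    by (intro map_pmf_cong) (auto simp: assigned_unit_def i_def inventory_def)
  also have "\<dots> = map_pmf (\<lambda>(b, s). (b, of_bool b + s)) (pair_pmf (D i) W)"
    unfolding D W_def A(1) by (rule Pi_pmf_insert_count[OF A(2,3)])
  finally have law: "map_pmf (\<lambda>s. (?S s, int k - inventory k (t - 1) s)) ?M =
      map_pmf (\<lambda>(b, s). (b, of_bool b + s)) (pair_pmf (D i) W)" .
  \<comment> \<open>A generic \<open>R\<close> serves the unconditional, marginal and joint
    probabilities alike. The shift \<open>1 + y\<close> counts the assigned unit when it is
    sold.\<close>
  have prob: "\<P>(s in ?M. R (?S s) (int k - inventory k (t - 1) s)) =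
      p * measure_pmf.prob W {y. R True (1 + y)} + (1 - p) * measure_pmf.prob W {y. R False y}" for R
  proof -
    have "\<P>(s in ?M. R (?S s) (int k - inventory k (t - 1) s)) =
        measure_pmf.prob (map_pmf (\<lambda>s. (?S s, int k - inventory k (t - 1) s)) ?M) {x. R (fst x) (snd x)}"
      by (simp add: vimage_def)
    also have "\<dots> = measure_pmf.prob (pair_pmf (D i) W) {x. R (fst x) (of_bool (fst x) + snd x)}"
      unfolding law by (simp add: vimage_def case_prod_beta)
    finally show ?thesis by (simp add: prob_pair_bool_pmf p_def)
  qed
  have p: "0 < p" "p < 1"
    using assms(8) prob[of "\<lambda>b _. b"] by simp_all
  have inv_iff: "inventory k (t - 1) s = k' \<longleftrightarrow> int k - inventory k (t - 1) s = int k - k'" for s k'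
    by auto
  have shift: "{y. 1 + y = n} = {n - 1}" for n :: int
    by auto
  have marginal: "\<P>(s in ?M. inventory k (t - 1) s = k') =
      p * a (int k - k' - 1) + (1 - p) * a (int k - k')" for k'
    unfolding inv_iff using prob[of "\<lambda>_ n. n = int k - k'"] by (simp add: shift a_def pmf.rep_eq)
  have joint: "\<P>(s in ?M. ?S s \<and> inventory k (t - 1) s = k') = p * a (int k - k' - 1)" for k'
    unfolding inv_iff using prob[of "\<lambda>b n. b \<and> n = int k - k'"] by (simp add: shift a_def pmf.rep_eq)
  obtain lo hi where conc: "strictly_log_concave_on lo hi a"
    using strictly_log_concave_on_bool_sum[OF A(2), of D] by (auto simp: a_def W_def)
  define n1 n2 where "n1 = int k - k1" and "n2 = int k - k2"
  have pos: "p * a (n1 - 1) + (1 - p) * a n1 > 0" "p * a (n2 - 1) + (1 - p) * a n2 > 0"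
    using assms(10,11) unfolding marginal n1_def n2_def by simp_all
  have supp: "a (n - 1) > 0 \<or> a n > 0" if "p * a (n - 1) + (1 - p) * a n > 0" for n
    using that strictly_log_concave_onD(2)[OF conc, of n] strictly_log_concave_onD(2)[OF conc, of "n - 1"]
    by (cases "a n = 0"; cases "a (n - 1) = 0") auto
  \<comment> \<open>More inventory means fewer sales: \<open>k1 < k2\<close> gives
    \<open>n2 < n1\<close>.\<close>
  have "a (n2 - 1) * a n1 < a n2 * a (n1 - 1)"
    using strictly_log_concave_on_pair_less[OF conc _ supp[OF pos(2)] supp[OF pos(1)]] \<open>k1 < k2\<close>
    by (simp add: n1_def n2_def)
  \<comment> \<open>This is the cross-multiplied form of the fraction inequality below, after the
    common term \<open>p * p * a (n1 - 1) * a (n2 - 1)\<close> cancels.\<close>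
  then have "p * (1 - p) * (a (n2 - 1) * a n1) < p * (1 - p) * (a n2 * a (n1 - 1))"
    using p by simp
  then have "p * a (n2 - 1) / (p * a (n2 - 1) + (1 - p) * a n2) <
      p * a (n1 - 1) / (p * a (n1 - 1) + (1 - p) * a n1)"
    using pos by (simp add: divide_less_eq less_divide_eq pos_divide_less_eq pos_less_divide_eq field_simps)
  then show ?thesis
    unfolding cond_prob_def joint marginal n1_def n2_def .
qed

end
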